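(* Every simple polygraphic program terminates, i.e. there is no infinite sequence of rewriting steps $f_0\to f_1\to f_2\to\cdots$ on its $2$-paths (using its structure and computation $3$-cells).
   Context: A monoidal $3$-polygraph consists of: $1$-cells (sorts); $1$-paths = finite words of $1$-cells (concatenation $\star_0$, empty word $\ast$); $2$-cells $\phi:s_1(\phi)\Rightarrow t_1(\phi)$ between $1$-paths ($m$ inputs, $n$ outputs = lengths of source and target); $2$-paths = morphisms of the free strict monoidal category generated by $1$- and $2$-cells (circuits modulo deformation), with sequential composition $\star_1$ and parallel composition $\star_0$; and $3$-cells $\alpha:s_2(\alpha)\Rrightarrow t_2(\alpha)$ between parallel $2$-paths. A rewriting step replaces an occurrence of $s_2(\alpha)$ in a $2$-path (in a context $h\star_1(x\star_0 s_2(\alpha)\star_0 y)\star_1 k$) by $t_2(\alpha)$. A polygraphic program is such a polygraph whose $2$-cells are: structure $2$-cells $\tau_{\xi,\zeta}:\xi\star_0\zeta\Rightarrow\zeta\star_0\xi$, $\delta_\xi:\xi\Rightarrow\xi\star_0\xi$, $\varepsilon_\xi:\xi\Rightarrow\ast$ (for all $1$-cells $\xi,\zeta$); constructors (a single $1$-cell as $1$-target); functions (other $2$-cells). Its $3$-cells are structure $3$-cells, for every constructor $\gamma:x\Rightarrow\xi$ and $1$-cell $\zeta$: $(\gamma\star_0\zeta)\star_1\tau_{\xi,\zeta}\Rrightarrow\tau_{x,\zeta}\star_1(\zeta\star_0\gamma)$, $(\zeta\star_0\gamma)\star_1\tau_{\zeta,\xi}\Rrightarrow\tau_{\zeta,x}\star_1(\gamma\star_0\zeta)$,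 $\gamma\star_1\delta_\xi\Rrightarrow\delta_x\star_1(\gamma\star_0\gamma)$, $\gamma\star_1\varepsilon_\xi\Rrightarrow\varepsilon_x$ ($\tau,\delta,\varepsilon$ extended to $1$-paths by structural induction), and computation $3$-cells whose $2$-source is $t\star_1\phi$ with $\phi$ a function and $t$ built only from $1$-cells and constructors. A polygraphic interpretation assigns to each $2$-path $f$ with $m$ inputs and $n$ outputs two monotone (componentwise nondecreasing) maps $f_*:\mathbb{N}^m\to\mathbb{N}^n$ and $[f]:\mathbb{N}^m\to\mathbb{N}$ such that: for a $1$-path $x$ of length $n$, $x_*=\mathrm{id}_{\mathbb{N}^n}$ and $[x]=0$; $(f\star_0 g)_*(\vec x,\vec y)=(f_*(\vec x),g_*(\vec y))$, $[f\star_0 g](\vec x,\vec y)=[f](\vec x)+[g](\vec y)$; $(f\star_1 g)_*(\vec x)=g_*(f_*(\vec x))$, $[f\star_1 g](\vec x)=[f](\vec x)+[g](f_*(\vec x))$. Write $\phi^j_*$ for the $j$-th component of $\phi_*$. It is compatible with a $3$-cell $\alpha$ when $s_2(\alpha)_*(\vec i)\ge t_2(\alpha)_*(\vec i)$ componentwise and $[s_2(\alpha)](\vec i)>[t_2(\alpha)](\vec i)$ for all $\vec i$. An interpretation is simple if: for every $2$-cell $\phi$ with $m$ inputs and $n$ outputs, $\sum_{j=1}^n\phi^j_*$ and $[\phi]$ are polynomials in $\mathbb{N}[x_1,\dots,x_m]$; for every constructor $\gamma$ with $m$ inputs, $\gamma_*=\sum_{i=1}^m x_i+a_\gamma$ with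 $a_\gamma>0$, $[\gamma]=0$, and some $a\in\mathbb{N}^*$ bounds all $a_\gamma$; $(\tau_{\xi,\zeta})_*(i,j)=(j,i)$, $(\delta_\xi)_*(i)=(i,i)$ and $[\tau]=[\delta]=[\varepsilon]=0$; for every function $\phi$ with $m$ inputs and $n$ outputs, $\sum_{j=1}^n\phi^j_*(i_1,\dots,i_m)\ge i_1+\cdots+i_m$. A polygraphic program is simple when there is a constant $K$ such that the $2$-target of each computation $3$-cell contains at most $K$ structure $2$-cells, and it admits a simple interpretation compatible with all of its computation $3$-cells. *)

theory Defs
  imports Main "HOL-Library.Poly_Mapping"
begin

section \<open>Monoidal polygraphs and their 2-paths\<close>

text \<open>1-paths are lists of 1-cells; \<open>@\<close> is the composition \<open>\<star>\<^sub>0\<close> on them and \<open>[]\<close> is the empty word.\<close>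

record ('s, 'g) polygraph2 =
  cells1 :: "'s set"
  cells2 :: "'g set"
  s1 :: "'g \<Rightarrow> 's list"
  t1 :: "'g \<Rightarrow> 's list"

datatype ('s, 'g) circuit =
    Idn "'s list"
  | Cell 'g
  | Par "('s, 'g) circuit" "('s, 'g) circuit" (infixr "\<star>\<^sub>0" 72)
  | Seq "('s, 'g) circuit" "('s, 'g) circuit" (infixr "\<star>\<^sub>1" 71)

inductive arrow :: "('s, 'g) polygraph2 \<Rightarrow> ('s, 'g) circuit \<Rightarrow> 's list \<Rightarrow> 's list \<Rightarrow> bool"
  for G where
  Idn: "x \<in> lists (cells1 G) \<Longrightarrow> arrow G (Idn x) x x"
| Cell: "\<phi> \<in> cells2 G \<Longrightarrow> arrow G (Cell \<phi>) (s1 G \<phi>) (t1 G \<phi>)"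
| Par: "\<lbrakk>arrow G f x y; arrow G g x' y'\<rbrakk> \<Longrightarrow> arrow G (f \<star>\<^sub>0 g) (x @ x') (y @ y')"
| Seq: "\<lbrakk>arrow G f x y; arrow G g y z\<rbrakk> \<Longrightarrow> arrow G (f \<star>\<^sub>1 g) x z"

text \<open>The congruence generated by the axioms of strict monoidal categories (with the 1-paths as
  monoid of objects): deformation of circuits. It relates well-typed circuits only.\<close>

inductive deform :: "('s, 'g) polygraph2 \<Rightarrow> ('s, 'g) circuit \<Rightarrow> ('s, 'g) circuit \<Rightarrow> bool"
  for G where
  refl: "arrow G f x y \<Longrightarrow> deform G f f"
| sym: "deform G f g \<Longrightarrow> deform G g f"
| trans: "\<lbrakk>deform G f g; deform G g h\<rbrakk> \<Longrightarrow> deform G f h"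
| par_cong: "\<lbrakk>deform G f f'; deform G g g'\<rbrakk> \<Longrightarrow> deform G (f \<star>\<^sub>0 g) (f' \<star>\<^sub>0 g')"
| seq_cong: "\<lbrakk>deform G f f'; deform G g g'; arrow G (f \<star>\<^sub>1 g) x y\<rbrakk>
    \<Longrightarrow> deform G (f \<star>\<^sub>1 g) (f' \<star>\<^sub>1 g')"
| par_assoc: "arrow G ((f \<star>\<^sub>0 g) \<star>\<^sub>0 h) x y \<Longrightarrow> deform G ((f \<star>\<^sub>0 g) \<star>\<^sub>0 h) (f \<star>\<^sub>0 (g \<star>\<^sub>0 h))"
| seq_assoc: "arrow G ((f \<star>\<^sub>1 g) \<star>\<^sub>1 h) x y \<Longrightarrow> deform G ((f \<star>\<^sub>1 g) \<star>\<^sub>1 h) (f \<star>\<^sub>1 (g \<star>\<^sub>1 h))"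
| par_unit_left: "arrow G f x y \<Longrightarrow> deform G (Idn [] \<star>\<^sub>0 f) f"
| par_unit_right: "arrow G f x y \<Longrightarrow> deform G (f \<star>\<^sub>0 Idn []) f"
| seq_unit_left: "arrow G f x y \<Longrightarrow> deform G (Idn x \<star>\<^sub>1 f) f"
| seq_unit_right: "arrow G f x y \<Longrightarrow> deform G (f \<star>\<^sub>1 Idn y) f"
| par_Idn: "\<lbrakk>x \<in> lists (cells1 G); y \<in> lists (cells1 G)\<rbrakk>
    \<Longrightarrow> deform G (Idn x \<star>\<^sub>0 Idn y) (Idn (x @ y))"
| interchange: "\<lbrakk>arrow G f x y; arrow G g y z; arrow G f' x' y'; arrow G g' y' z'\<rbrakk>
    \<Longrightarrow> deform G ((f \<star>\<^sub>1 g) \<star>\<^sub>0 (f' \<star>\<^sub>1 g')) ((f \<star>\<^sub>0 f') \<star>\<^sub>1 (g \<star>\<^sub>0 g'))"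

type_synonym ('s, 'g) path2 = "('s, 'g) circuit set"

definition cls :: "('s, 'g) polygraph2 \<Rightarrow> ('s, 'g) circuit \<Rightarrow> ('s, 'g) path2" where
  "cls G f = {g. deform G f g}"

text \<open>\<open>path2 G F x y\<close>: \<open>F\<close> is a 2-path from the 1-path \<open>x\<close> to the 1-path \<open>y\<close>.\<close>

definition path2 :: "('s, 'g) polygraph2 \<Rightarrow> ('s, 'g) path2 \<Rightarrow> 's list \<Rightarrow> 's list \<Rightarrow> bool" where
  "path2 G F x y \<longleftrightarrow> (\<exists>f. arrow G f x y \<and> F = cls G f)"

definition id2 :: "('s, 'g) polygraph2 \<Rightarrow> 's list \<Rightarrow> ('s, 'g) path2" where
  "id2 G x = cls G (Idn x)"

definition cell2 :: "('s, 'g) polygraph2 \<Rightarrow> 'g \<Rightarrow> ('s, 'g) path2" where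
  "cell2 G \<phi> = cls G (Cell \<phi>)"

definition par2 :: "('s, 'g) polygraph2 \<Rightarrow> ('s, 'g) path2 \<Rightarrow> ('s, 'g) path2 \<Rightarrow> ('s, 'g) path2" where
  "par2 G F F' = {h. \<exists>f \<in> F. \<exists>f' \<in> F'. deform G (f \<star>\<^sub>0 f') h}"

text \<open>The result is a 2-path (rather than \<open>{}\<close>) only for composable \<open>F\<close> and \<open>F'\<close>.\<close>

definition seq2 :: "('s, 'g) polygraph2 \<Rightarrow> ('s, 'g) path2 \<Rightarrow> ('s, 'g) path2 \<Rightarrow> ('s, 'g) path2" where
  "seq2 G F F' = {h. \<exists>f \<in> F. \<exists>f' \<in> F'. deform G (f \<star>\<^sub>1 f') h}"

text \<open>Number of occurrences of 2-cells from \<open>A\<close>; it is invariant under \<open>deform\<close>.\<close>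

primrec occurrences :: "'g set \<Rightarrow> ('s, 'g) circuit \<Rightarrow> nat" where
  "occurrences A (Idn x) = 0"
| "occurrences A (Cell \<phi>) = (if \<phi> \<in> A then 1 else 0)"
| "occurrences A (f \<star>\<^sub>0 g) = occurrences A f + occurrences A g"
| "occurrences A (f \<star>\<^sub>1 g) = occurrences A f + occurrences A g"

section \<open>3-polygraphs and rewriting\<close>

record ('s, 'g, 'r) polygraph3 =
  base :: "('s, 'g) polygraph2"
  cells3 :: "'r set"
  s2 :: "'r \<Rightarrow> ('s, 'g) path2"
  t2 :: "'r \<Rightarrow> ('s, 'g) path2"

definition polygraph3_wf :: "('s, 'g, 'r) polygraph3 \<Rightarrow> bool" where
  "polygraph3_wf P \<longleftrightarrow>
     (\<forall>\<phi> \<in> cells2 (base P). s1 (base P) \<phi> \<in> lists (cells1 (base P)) \<and>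
                           t1 (base P) \<phi> \<in> lists (cells1 (base P))) \<and>
     (\<forall>\<alpha> \<in> cells3 P. \<exists>x y. path2 (base P) (s2 P \<alpha>) x y \<and> path2 (base P) (t2 P \<alpha>) x y)"

definition in_context :: "('s, 'g) polygraph2 \<Rightarrow> ('s, 'g) path2 \<Rightarrow> 's list \<Rightarrow> 's list \<Rightarrow>
    ('s, 'g) path2 \<Rightarrow> ('s, 'g) path2 \<Rightarrow> ('s, 'g) path2" where
  "in_context G h x y k F = seq2 G (seq2 G h (par2 G (par2 G (id2 G x) F) (id2 G y))) k"

definition rewrite_step :: "('s, 'g, 'r) polygraph3 \<Rightarrow> ('s, 'g) path2 \<Rightarrow> ('s, 'g) path2 \<Rightarrow> bool" where
  "rewrite_step P F F' \<longleftrightarrow>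
     (\<exists>\<alpha> h x y k u v p q. \<alpha> \<in> cells3 P \<and>
        path2 (base P) (s2 P \<alpha>) p q \<and> path2 (base P) (t2 P \<alpha>) p q \<and>
        x \<in> lists (cells1 (base P)) \<and> y \<in> lists (cells1 (base P)) \<and>
        path2 (base P) h u (x @ p @ y) \<and> path2 (base P) k (x @ q @ y) v \<and>
        F = in_context (base P) h x y k (s2 P \<alpha>) \<and>
        F' = in_context (base P) h x y k (t2 P \<alpha>))"

section \<open>Polygraphic programs\<close>

datatype ('s, 'c, 'f) prog_cell2 = Tau 's 's | Delta 's | Eps 's | Con 'c | Fun 'f

text \<open>The four families of structure 3-cells, and the computation 3-cells.\<close>

datatype ('s, 'c, 'r) prog_cell3 =
  TauConL 'c 's | TauConR 's 'c | DeltaCon 'c | EpsCon 'c | Comp 'r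

text \<open>The structure 2- and 3-cells are determined by the sorts and constructors, so a program is
  given by the remaining data. A constructor has a single sort as its 1-target.\<close>

record ('s, 'c, 'f, 'r) program =
  sorts :: "'s set"
  constrs :: "'c set"
  funcs :: "'f set"
  comps :: "'r set"
  con_src :: "'c \<Rightarrow> 's list"
  con_tgt :: "'c \<Rightarrow> 's"
  fun_src :: "'f \<Rightarrow> 's list"
  fun_tgt :: "'f \<Rightarrow> 's list"
  comp_src :: "'r \<Rightarrow> ('s, ('s, 'c, 'f) prog_cell2) path2"
  comp_tgt :: "'r \<Rightarrow> ('s, ('s, 'c, 'f) prog_cell2) path2"

definition structure_cells :: "('s, 'c, 'f, 'r) program \<Rightarrow> ('s, 'c, 'f) prog_cell2 set" where
  "structure_cells P =
     {Tau \<xi> \<zeta> | \<xi> \<zeta>. \<xi> \<in> sorts P \<and> \<zeta> \<in> sorts P} \<union> Delta ` sorts P \<union> Eps ` sorts P"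

primrec prog_s1 :: "('s, 'c, 'f, 'r) program \<Rightarrow> ('s, 'c, 'f) prog_cell2 \<Rightarrow> 's list" where
  "prog_s1 P (Tau \<xi> \<zeta>) = [\<xi>, \<zeta>]"
| "prog_s1 P (Delta \<xi>) = [\<xi>]"
| "prog_s1 P (Eps \<xi>) = [\<xi>]"
| "prog_s1 P (Con \<gamma>) = con_src P \<gamma>"
| "prog_s1 P (Fun \<phi>) = fun_src P \<phi>"

primrec prog_t1 :: "('s, 'c, 'f, 'r) program \<Rightarrow> ('s, 'c, 'f) prog_cell2 \<Rightarrow> 's list" where
  "prog_t1 P (Tau \<xi> \<zeta>) = [\<zeta>, \<xi>]"
| "prog_t1 P (Delta \<xi>) = [\<xi>, \<xi>]"
| "prog_t1 P (Eps \<xi>) = []"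
| "prog_t1 P (Con \<gamma>) = [con_tgt P \<gamma>]"
| "prog_t1 P (Fun \<phi>) = fun_tgt P \<phi>"

definition prog_base :: "('s, 'c, 'f, 'r) program \<Rightarrow> ('s, ('s, 'c, 'f) prog_cell2) polygraph2" where
  "prog_base P =
     \<lparr>cells1 = sorts P,
      cells2 = structure_cells P \<union> Con ` constrs P \<union> Fun ` funcs P,
      s1 = prog_s1 P,
      t1 = prog_t1 P\<rparr>"

text \<open>Extensions of \<open>\<tau>\<close>, \<open>\<delta>\<close>, \<open>\<epsilon>\<close> to 1-paths: \<open>tau_cell \<xi> y : \<xi> y \<Rightarrow> y \<xi>\<close>,
  \<open>tau_path x y : x y \<Rightarrow> y x\<close>, \<open>delta_path x : x \<Rightarrow> x x\<close>, \<open>eps_path x : x \<Rightarrow> []\<close>.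
  Recursing from the other end of the word gives the same 2-paths.\<close>

primrec tau_cell :: "'s \<Rightarrow> 's list \<Rightarrow> ('s, ('s, 'c, 'f) prog_cell2) circuit" where
  "tau_cell \<xi> [] = Idn [\<xi>]"
| "tau_cell \<xi> (\<zeta> # y) = (Cell (Tau \<xi> \<zeta>) \<star>\<^sub>0 Idn y) \<star>\<^sub>1 (Idn [\<zeta>] \<star>\<^sub>0 tau_cell \<xi> y)"

primrec tau_path :: "'s list \<Rightarrow> 's list \<Rightarrow> ('s, ('s, 'c, 'f) prog_cell2) circuit" where
  "tau_path [] y = Idn y"
| "tau_path (\<xi> # x) y = (Idn [\<xi>] \<star>\<^sub>0 tau_path x y) \<star>\<^sub>1 (tau_cell \<xi> y \<star>\<^sub>0 Idn x)"

primrec delta_path :: "'s list \<Rightarrow> ('s, ('s, 'c, 'f) prog_cell2) circuit" where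
  "delta_path [] = Idn []"
| "delta_path (\<xi> # x) =
     (Cell (Delta \<xi>) \<star>\<^sub>0 delta_path x) \<star>\<^sub>1 (Idn [\<xi>] \<star>\<^sub>0 tau_path [\<xi>] x \<star>\<^sub>0 Idn x)"

primrec eps_path :: "'s list \<Rightarrow> ('s, ('s, 'c, 'f) prog_cell2) circuit" where
  "eps_path [] = Idn []"
| "eps_path (\<xi> # x) = Cell (Eps \<xi>) \<star>\<^sub>0 eps_path x"

primrec prog_s2 :: "('s, 'c, 'f, 'r) program \<Rightarrow> ('s, 'c, 'r) prog_cell3 \<Rightarrow>
    ('s, ('s, 'c, 'f) prog_cell2) path2" where
  "prog_s2 P (TauConL \<gamma> \<zeta>) =
     cls (prog_base P) ((Cell (Con \<gamma>) \<star>\<^sub>0 Idn [\<zeta>]) \<star>\<^sub>1 Cell (Tau (con_tgt P \<gamma>) \<zeta>))"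
| "prog_s2 P (TauConR \<zeta> \<gamma>) =
     cls (prog_base P) ((Idn [\<zeta>] \<star>\<^sub>0 Cell (Con \<gamma>)) \<star>\<^sub>1 Cell (Tau \<zeta> (con_tgt P \<gamma>)))"
| "prog_s2 P (DeltaCon \<gamma>) = cls (prog_base P) (Cell (Con \<gamma>) \<star>\<^sub>1 Cell (Delta (con_tgt P \<gamma>)))"
| "prog_s2 P (EpsCon \<gamma>) = cls (prog_base P) (Cell (Con \<gamma>) \<star>\<^sub>1 Cell (Eps (con_tgt P \<gamma>)))"
| "prog_s2 P (Comp r) = comp_src P r"

primrec prog_t2 :: "('s, 'c, 'f, 'r) program \<Rightarrow> ('s, 'c, 'r) prog_cell3 \<Rightarrow>
    ('s, ('s, 'c, 'f) prog_cell2) path2" where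
  "prog_t2 P (TauConL \<gamma> \<zeta>) =
     cls (prog_base P) (tau_path (con_src P \<gamma>) [\<zeta>] \<star>\<^sub>1 (Idn [\<zeta>] \<star>\<^sub>0 Cell (Con \<gamma>)))"
| "prog_t2 P (TauConR \<zeta> \<gamma>) =
     cls (prog_base P) (tau_path [\<zeta>] (con_src P \<gamma>) \<star>\<^sub>1 (Cell (Con \<gamma>) \<star>\<^sub>0 Idn [\<zeta>]))"
| "prog_t2 P (DeltaCon \<gamma>) =
     cls (prog_base P) (delta_path (con_src P \<gamma>) \<star>\<^sub>1 (Cell (Con \<gamma>) \<star>\<^sub>0 Cell (Con \<gamma>)))"
| "prog_t2 P (EpsCon \<gamma>) = cls (prog_base P) (eps_path (con_src P \<gamma>))"
| "prog_t2 P (Comp r) = comp_tgt P r"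

definition prog_polygraph :: "('s, 'c, 'f, 'r) program \<Rightarrow>
    ('s, ('s, 'c, 'f) prog_cell2, ('s, 'c, 'r) prog_cell3) polygraph3" where
  "prog_polygraph P =
     \<lparr>base = prog_base P,
      cells3 = {TauConL \<gamma> \<zeta> | \<gamma> \<zeta>. \<gamma> \<in> constrs P \<and> \<zeta> \<in> sorts P} \<union>
               {TauConR \<zeta> \<gamma> | \<zeta> \<gamma>. \<gamma> \<in> constrs P \<and> \<zeta> \<in> sorts P} \<union>
               DeltaCon ` constrs P \<union> EpsCon ` constrs P \<union> Comp ` comps P,
      s2 = prog_s2 P,
      t2 = prog_t2 P\<rparr>"

text \<open>In the second clause, \<open>t\<close> is built from 1-cells and constructors only (for one, equivalently
  for each, of the circuits representing it).\<close>

definition polygraphic_program :: "('s, 'c, 'f, 'r) program \<Rightarrow> bool" where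
  "polygraphic_program P \<longleftrightarrow>
     polygraph3_wf (prog_polygraph P) \<and>
     (\<forall>r \<in> comps P. \<exists>t \<phi> x. \<phi> \<in> funcs P \<and>
        path2 (prog_base P) t x (fun_src P \<phi>) \<and>
        (\<forall>f \<in> t. occurrences (- Con ` constrs P) f = 0) \<and>
        comp_src P r = seq2 (prog_base P) t (cell2 (prog_base P) (Fun \<phi>)))"

section \<open>Polygraphic interpretations\<close>

text \<open>\<open>val F\<close> and \<open>heat F\<close> are \<open>F\<^sub>*\<close> and \<open>[F]\<close>. A vector in \<open>\<nat>\<^sup>m\<close> is a list of length \<open>m\<close>; the
  values on lists of other lengths are irrelevant.\<close>

locale polygraphic_interpretation =
  fixes G :: "('s, 'g) polygraph2"
    and val :: "('s, 'g) path2 \<Rightarrow> nat list \<Rightarrow> nat list"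
    and heat :: "('s, 'g) path2 \<Rightarrow> nat list \<Rightarrow> nat"
  assumes val_length:
      "\<lbrakk>path2 G F x y; length us = length x\<rbrakk> \<Longrightarrow> length (val F us) = length y"
    and val_mono:
      "\<lbrakk>path2 G F x y; length us = length x; list_all2 (\<le>) us vs\<rbrakk>
        \<Longrightarrow> list_all2 (\<le>) (val F us) (val F vs)"
    and heat_mono:
      "\<lbrakk>path2 G F x y; length us = length x; list_all2 (\<le>) us vs\<rbrakk> \<Longrightarrow> heat F us \<le> heat F vs"
    and val_id:
      "\<lbrakk>x \<in> lists (cells1 G); length us = length x\<rbrakk> \<Longrightarrow> val (id2 G x) us = us"
    and heat_id:
      "\<lbrakk>x \<in> lists (cells1 G); length us = length x\<rbrakk> \<Longrightarrow> heat (id2 G x) us = 0"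
    and val_par:
      "\<lbrakk>path2 G F x y; path2 G F' x' y'; length us = length x; length vs = length x'\<rbrakk>
        \<Longrightarrow> val (par2 G F F') (us @ vs) = val F us @ val F' vs"
    and heat_par:
      "\<lbrakk>path2 G F x y; path2 G F' x' y'; length us = length x; length vs = length x'\<rbrakk>
        \<Longrightarrow> heat (par2 G F F') (us @ vs) = heat F us + heat F' vs"
    and val_seq:
      "\<lbrakk>path2 G F x y; path2 G F' y z; length us = length x\<rbrakk>
        \<Longrightarrow> val (seq2 G F F') us = val F' (val F us)"
    and heat_seq:
      "\<lbrakk>path2 G F x y; path2 G F' y z; length us = length x\<rbrakk>
        \<Longrightarrow> heat (seq2 G F F') us = heat F us + heat F' (val F us)"

definition compatible_with :: "('s, 'g, 'r) polygraph3 \<Rightarrow>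
    (('s, 'g) path2 \<Rightarrow> nat list \<Rightarrow> nat list) \<Rightarrow> (('s, 'g) path2 \<Rightarrow> nat list \<Rightarrow> nat) \<Rightarrow> 'r \<Rightarrow> bool" where
  "compatible_with P val heat \<alpha> \<longleftrightarrow>
     (\<forall>x y us. path2 (base P) (s2 P \<alpha>) x y \<and> length us = length x \<longrightarrow>
        list_all2 (\<ge>) (val (s2 P \<alpha>) us) (val (t2 P \<alpha>) us) \<and>
        heat (s2 P \<alpha>) us > heat (t2 P \<alpha>) us)"

text \<open>The finitely supported maps \<open>(nat \<Rightarrow>\<^sub>0 nat) \<Rightarrow>\<^sub>0 nat\<close> are the polynomials over \<open>\<nat>\<close>, as
  assignments of coefficients to monomials.\<close>

definition nat_polynomial :: "nat \<Rightarrow> (nat list \<Rightarrow> nat) \<Rightarrow> bool" where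
  "nat_polynomial m F \<longleftrightarrow>
     (\<exists>p :: (nat \<Rightarrow>\<^sub>0 nat) \<Rightarrow>\<^sub>0 nat.
        (\<forall>e \<in> Poly_Mapping.keys p. Poly_Mapping.keys e \<subseteq> {..<m}) \<and>
        (\<forall>us. length us = m \<longrightarrow>
           F us = (\<Sum>e \<in> Poly_Mapping.keys p.
             Poly_Mapping.lookup p e * (\<Prod>i<m. us ! i ^ Poly_Mapping.lookup e i))))"

locale simple_interpretation = polygraphic_interpretation "prog_base P" val heat
  for P :: "('s, 'c, 'f, 'r) program" and val and heat +
  assumes val_polynomial:
      "\<phi> \<in> cells2 (prog_base P) \<Longrightarrow>
        nat_polynomial (length (prog_s1 P \<phi>)) (\<lambda>us. sum_list (val (cell2 (prog_base P) \<phi>) us))"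
    and heat_polynomial:
      "\<phi> \<in> cells2 (prog_base P) \<Longrightarrow>
        nat_polynomial (length (prog_s1 P \<phi>)) (heat (cell2 (prog_base P) \<phi>))"
    and val_constructor:
      "\<exists>a>0. \<forall>\<gamma> \<in> constrs P. \<exists>a\<^sub>\<gamma>>0. a\<^sub>\<gamma> \<le> a \<and>
        (\<forall>us. length us = length (con_src P \<gamma>) \<longrightarrow>
           val (cell2 (prog_base P) (Con \<gamma>)) us = [sum_list us + a\<^sub>\<gamma>])"
    and heat_constructor:
      "\<lbrakk>\<gamma> \<in> constrs P; length us = length (con_src P \<gamma>)\<rbrakk>
        \<Longrightarrow> heat (cell2 (prog_base P) (Con \<gamma>)) us = 0"
    and val_Tau:
      "\<lbrakk>\<xi> \<in> sorts P; \<zeta> \<in> sorts P\<rbrakk> \<Longrightarrow> val (cell2 (prog_base P) (Tau \<xi> \<zeta>)) [i, j] = [j, i]"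
    and val_Delta:
      "\<xi> \<in> sorts P \<Longrightarrow> val (cell2 (prog_base P) (Delta \<xi>)) [i] = [i, i]"
    and heat_Tau:
      "\<lbrakk>\<xi> \<in> sorts P; \<zeta> \<in> sorts P\<rbrakk> \<Longrightarrow> heat (cell2 (prog_base P) (Tau \<xi> \<zeta>)) [i, j] = 0"
    and heat_Delta:
      "\<xi> \<in> sorts P \<Longrightarrow> heat (cell2 (prog_base P) (Delta \<xi>)) [i] = 0"
    and heat_Eps:
      "\<xi> \<in> sorts P \<Longrightarrow> heat (cell2 (prog_base P) (Eps \<xi>)) [i] = 0"
    and val_function:
      "\<lbrakk>\<psi> \<in> funcs P; length us = length (fun_src P \<psi>)\<rbrakk>
        \<Longrightarrow> sum_list (val (cell2 (prog_base P) (Fun \<psi>)) us) \<ge> sum_list us"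

definition simple_program :: "('s, 'c, 'f, 'r) program \<Rightarrow> bool" where
  "simple_program P \<longleftrightarrow>
     polygraphic_program P \<and>
     (\<exists>K. \<forall>r \<in> comps P. \<forall>f \<in> comp_tgt P r. occurrences (structure_cells P) f \<le> K) \<and>
     (\<exists>val heat. simple_interpretation P val heat \<and>
        (\<forall>r \<in> comps P. compatible_with (prog_polygraph P) val heat (Comp r)))"

end

theory Submission
  imports Defs
begin

text \<open>A computation step strictly decreases the heat of the given interpretation, whereas a
  structure step preserves its values and heat. So it suffices that the structure 3-cells alone
  terminate, which is shown by a second interpretation, made for the structure cells: with every
  wire weighing one more than its value, a constructor outputs a wire heavier than all its inputs
  together, and the heat of \<open>\<tau>\<close>, \<open>\<delta>\<close>, \<open>\<epsilon>\<close> is the product of the weights of the two inputs, the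
  square of the weight and the weight, respectively. Pulling a structure cell above a constructor
  keeps the values and decreases this heat, and the two heats decrease lexicographically.\<close>

section \<open>Typing of 2-paths\<close>

text \<open>The part of \<open>polygraph3_wf\<close> that concerns 2-cells, as a condition on
  \<open>G\<close> alone; it makes the boundary of every typed circuit a pair of 1-paths over
  \<open>cells1 G\<close>.\<close>

definition polygraph2_wf :: "('s, 'g) polygraph2 \<Rightarrow> bool" where
  "polygraph2_wf G \<longleftrightarrow>
     (\<forall>\<phi> \<in> cells2 G. s1 G \<phi> \<in> lists (cells1 G) \<and> t1 G \<phi> \<in> lists (cells1 G))"

inductive_cases arrow_IdnE: "arrow G (Idn x) u v"
inductive_cases arrow_CellE: "arrow G (Cell \<phi>) u v"
inductive_cases arrow_ParE: "arrow G (f \<star>\<^sub>0 g) u v"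
inductive_cases arrow_SeqE: "arrow G (f \<star>\<^sub>1 g) u v"

text \<open>Typing is directed by syntax: \<open>Idn\<close> carries its 1-path, and each of the
  other constructors has a single rule.\<close>

lemma arrow_unique:
  assumes "arrow G f x y" "arrow G f x' y'"
  shows "x' = x \<and> y' = y"
  using assms
proof (induction arbitrary: x' y')
  case (Idn x) then show ?case by (auto elim: arrow_IdnE)
next
  case (Cell \<phi>) then show ?case by (auto elim: arrow_CellE)
next
  case (Par f x y g x' y' x2 y2)
  from Par.prems obtain a b c d where a: "arrow G f a b" "arrow G g c d"
    and eq: "x2 = a @ c" "y2 = b @ d" by (rule arrow_ParE)
  from Par.IH(1)[OF a(1)] Par.IH(2)[OF a(2)] eq show ?case by simp
next
  case (Seq f x y g z)
  from Seq.prems obtain w where a: "arrow G f x' w" "arrow G g w y'" by (rule arrow_SeqE)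
  from Seq.IH(1)[OF a(1)] Seq.IH(2)[OF a(2)] show ?case by simp
qed

lemma arrow_lists:
  assumes "polygraph2_wf G" "arrow G f x y"
  shows "x \<in> lists (cells1 G) \<and> y \<in> lists (cells1 G)"
  using assms(2) by induction (use assms(1) in \<open>auto simp: polygraph2_wf_def\<close>)

text \<open>Both sides of every monoidal axiom have the same type. Well-formedness enters with the
  unit laws of \<open>\<star>\<^sub>1\<close>, where the inserted identity must itself be
  typed.\<close>

lemma deform_arrow:
  assumes wf: "polygraph2_wf G" and "deform G f g"
  shows "\<exists>x y. arrow G f x y \<and> arrow G g x y"
  using assms(2)
proof induction
  case (trans f g h)
  then show ?case by (metis arrow_unique)
next
  case (par_cong f f' g g')
  then obtain x y x' y' where "arrow G f x y" "arrow G f' x y" "arrow G g x' y'" "arrow G g' x' y'"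
    by blast
  then show ?case using arrow.Par by blast
next
  case (seq_cong f f' g g' x y)
  from seq_cong.hyps(3) obtain w where "arrow G f x w" "arrow G g w y"
    by (auto elim: arrow_SeqE)
  \<comment> \<open>The induction hypotheses give some type for each factor; uniqueness forces these
    types to share the middle 1-path \<open>w\<close>.\<close>
  moreover from this seq_cong.IH have "arrow G f' x w" "arrow G g' w y"
    by (metis arrow_unique)+
  ultimately show ?case by (meson arrow.Seq)
next
  case (par_assoc f g h x y)
  then obtain x1 y1 x2 y2 x3 y3
    where a: "arrow G f x1 y1" "arrow G g x2 y2" "arrow G h x3 y3"
      and "x = (x1 @ x2) @ x3" "y = (y1 @ y2) @ y3"
    by (elim arrow_ParE) auto
  with arrow.Par[OF a(1) arrow.Par[OF a(2,3)]] par_assoc show ?case by auto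
next
  case (seq_assoc f g h x y)
  then show ?case by (elim arrow_SeqE) (blast intro: arrow.Seq)
next
  case (par_unit_left f x y)
  with arrow.Par[OF arrow.Idn[of "[]"] par_unit_left] show ?case by auto
next
  case (par_unit_right f x y)
  with arrow.Par[OF par_unit_right arrow.Idn[of "[]"]] show ?case by auto
next
  case (seq_unit_left f x y)
  then show ?case using arrow_lists[OF wf seq_unit_left] arrow.Seq[OF arrow.Idn seq_unit_left] by blast
next
  case (seq_unit_right f x y)
  then show ?case using arrow_lists[OF wf seq_unit_right] arrow.Seq[OF seq_unit_right arrow.Idn] by blast
next
  case (par_Idn x y)
  then have "arrow G (Idn (x @ y)) (x @ y) (x @ y)" by (intro arrow.Idn) auto
  with arrow.Par[OF arrow.Idn[OF par_Idn(1)] arrow.Idn[OF par_Idn(2)]] show ?case by blast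
next
  case (interchange f x y g z f' x' y' g' z')
  note h = interchange.hyps
  from arrow.Par[OF arrow.Seq[OF h(1,2)] arrow.Seq[OF h(3,4)]]
    arrow.Seq[OF arrow.Par[OF h(1,3)] arrow.Par[OF h(2,4)]]
  show ?case by blast
qed auto

section \<open>Operations on deformation classes through representatives\<close>

lemma in_cls_self: "arrow G f x y \<Longrightarrow> f \<in> cls G f"
  by (auto simp: cls_def intro: deform.refl)

lemma path2_cls: "arrow G f x y \<Longrightarrow> path2 G (cls G f) x y"
  by (auto simp: path2_def)

text \<open>Two representatives of the same class are deformations of each other, hence have a
  common type.\<close>

lemma path2_unique:
  assumes "polygraph2_wf G" "path2 G F x y" "path2 G F x' y'"
  shows "x' = x \<and> y' = y"
proof -
  obtain f f' where f: "arrow G f x y" "F = cls G f" and f': "arrow G f' x' y'" "F = cls G f'"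
    using assms by (auto simp: path2_def)
  have "f' \<in> cls G f" using in_cls_self[OF f'(1)] f(2) f'(2) by simp
  then have "deform G f f'" by (simp add: cls_def)
  then obtain x0 y0 where "arrow G f x0 y0" "arrow G f' x0 y0"
    using deform_arrow[OF assms(1)] by blast
  with arrow_unique[OF f(1)] arrow_unique[OF f'(1)] show ?thesis by simp
qed

text \<open>Composing classes amounts to composing representatives, because \<open>deform\<close> is
  a congruence. Typing ensures that \<open>f\<close> and \<open>g\<close> lie in their own classes,
  as \<open>deform\<close> is reflexive on typed circuits only.\<close>

lemma par2_cls:
  assumes "arrow G f x y" "arrow G g x' y'"
  shows "par2 G (cls G f) (cls G g) = cls G (f \<star>\<^sub>0 g)"
proof (intro set_eqI iffI)
  fix h assume "h \<in> par2 G (cls G f) (cls G g)"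
  then obtain f' g' where d: "deform G f f'" "deform G g g'" "deform G (f' \<star>\<^sub>0 g') h"
    unfolding par2_def cls_def by blast
  from deform.trans[OF deform.par_cong[OF d(1,2)] d(3)] show "h \<in> cls G (f \<star>\<^sub>0 g)"
    by (simp add: cls_def)
next
  fix h assume "h \<in> cls G (f \<star>\<^sub>0 g)"
  then have "deform G (f \<star>\<^sub>0 g) h" by (simp add: cls_def)
  with in_cls_self[OF assms(1)] in_cls_self[OF assms(2)] show "h \<in> par2 G (cls G f) (cls G g)"
    unfolding par2_def by blast
qed

lemma seq2_cls:
  assumes "arrow G f x y" "arrow G g y z"
  shows "seq2 G (cls G f) (cls G g) = cls G (f \<star>\<^sub>1 g)"
proof (intro set_eqI iffI)
  fix h assume "h \<in> seq2 G (cls G f) (cls G g)"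
  then obtain f' g' where d: "deform G f f'" "deform G g g'" "deform G (f' \<star>\<^sub>1 g') h"
    unfolding seq2_def cls_def by blast
  from deform.trans[OF deform.seq_cong[OF d(1,2) arrow.Seq[OF assms]] d(3)] show "h \<in> cls G (f \<star>\<^sub>1 g)"
    by (simp add: cls_def)
next
  fix h assume "h \<in> cls G (f \<star>\<^sub>1 g)"
  then have "deform G (f \<star>\<^sub>1 g) h" by (simp add: cls_def)
  with in_cls_self[OF assms(1)] in_cls_self[OF assms(2)] show "h \<in> seq2 G (cls G f) (cls G g)"
    unfolding seq2_def by blast
qed

lemma path2_id2: "x \<in> lists (cells1 G) \<Longrightarrow> path2 G (id2 G x) x x"
  by (simp add: id2_def arrow.Idn path2_cls)

lemma path2_par2:
  "\<lbrakk>path2 G F x y; path2 G F' x' y'\<rbrakk> \<Longrightarrow> path2 G (par2 G F F') (x @ x') (y @ y')"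
  unfolding path2_def by (metis arrow.Par par2_cls)

lemma path2_seq2:
  "\<lbrakk>path2 G F x y; path2 G F' y z\<rbrakk> \<Longrightarrow> path2 G (seq2 G F F') x z"
  unfolding path2_def by (metis arrow.Seq seq2_cls)

section \<open>Interpretations in context\<close>

context polygraphic_interpretation
begin

text \<open>One judgement bundles type, input, heat and output, so that the evaluation of a large
  circuit is assembled by rules that follow its syntax.\<close>

definition evals :: "('s, 'g) circuit \<Rightarrow> 's list \<Rightarrow> 's list \<Rightarrow> nat list \<Rightarrow> nat \<Rightarrow> nat list \<Rightarrow> bool" where
  "evals f x y us h vs \<longleftrightarrow> arrow G f x y \<and> length us = length x \<and>
     val (cls G f) us = vs \<and> heat (cls G f) us = h"

lemma evals_Idn: "\<lbrakk>x \<in> lists (cells1 G); length us = length x\<rbrakk> \<Longrightarrow> evals (Idn x) x x us 0 us"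
  using val_id heat_id by (auto simp: evals_def id2_def intro: arrow.Idn)

lemma evals_Cell:
  assumes "\<phi> \<in> cells2 G" "length us = length (s1 G \<phi>)"
  shows "evals (Cell \<phi>) (s1 G \<phi>) (t1 G \<phi>) us (heat (cell2 G \<phi>) us) (val (cell2 G \<phi>) us)"
  using assms by (auto simp: evals_def cell2_def intro: arrow.Cell)

lemma evals_Par:
  assumes "evals f x y us h vs" "evals g x' y' us' h' vs'"
  shows "evals (f \<star>\<^sub>0 g) (x @ x') (y @ y') (us @ us') (h + h') (vs @ vs')"
proof -
  have "arrow G f x y" "arrow G g x' y'" "length us = length x" "length us' = length x'"
    using assms by (auto simp: evals_def)
  then show ?thesis
    using assms val_par[of "cls G f" x y "cls G g" x' y' us us']
      heat_par[of "cls G f" x y "cls G g" x' y' us us']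
    by (auto simp: evals_def par2_cls path2_cls intro: arrow.Par)
qed

lemma evals_Seq:
  assumes "evals f x y us h vs" "evals g y z vs h' ws"
  shows "evals (f \<star>\<^sub>1 g) x z us (h + h') ws"
proof -
  have "arrow G f x y" "arrow G g y z" "length us = length x"
    using assms by (auto simp: evals_def)
  then show ?thesis
    using assms val_seq[of "cls G f" x y "cls G g" z us] heat_seq[of "cls G f" x y "cls G g" z us]
    by (auto simp: evals_def seq2_cls path2_cls intro: arrow.Seq)
qed

text \<open>The identities on \<open>x\<close> and \<open>y\<close> produce no heat and pass
  \<open>as\<close> and \<open>bs\<close> on unchanged, so the total is the heat of
  \<open>h\<close>, of \<open>F\<close> on its own inputs, and of \<open>k\<close> on the
  outputs.\<close>

lemma heat_in_context:
  assumes h: "path2 G h u (x @ p @ y)" and k: "path2 G k (x @ q @ y) v"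
    and F: "path2 G F p q" and xy: "x \<in> lists (cells1 G)" "y \<in> lists (cells1 G)"
    and us: "length us = length u"
    and split: "val h us = as @ ws @ bs"
      "length as = length x" "length ws = length p" "length bs = length y"
  shows "heat (in_context G h x y k F) us = heat h us + heat F ws + heat k (as @ val F ws @ bs)"
proof -
  let ?M = "par2 G (par2 G (id2 G x) F) (id2 G y)"
  have xF: "path2 G (par2 G (id2 G x) F) (x @ p) (x @ q)"
    using path2_par2[OF path2_id2 F] xy by simp
  have M: "path2 G ?M (x @ p @ y) (x @ q @ y)"
    using path2_par2[OF xF path2_id2] xy by simp
  have "val ?M (as @ ws @ bs) = as @ val F ws @ bs" "heat ?M (as @ ws @ bs) = heat F ws"
    using val_par[OF xF path2_id2, of y "as @ ws" bs] val_par[OF path2_id2 F, of x as ws]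
      heat_par[OF xF path2_id2, of y "as @ ws" bs] heat_par[OF path2_id2 F, of x as ws]
      val_id heat_id xy split by auto
  then show ?thesis
    unfolding in_context_def
    using heat_seq[OF path2_seq2[OF h M] k us] heat_seq[OF h M us] val_seq[OF h M us] split by simp
qed

text \<open>\<open>h\<close> sees the same input in both cases, and the smaller output of
  \<open>F'\<close> can only lower the heat of \<open>k\<close>, by monotonicity. The amount
  \<open>d\<close> covers a strict decrease (\<open>d = 1\<close>) and a weak one
  (\<open>d = 0\<close>) at once.\<close>

lemma heat_in_context_decrease:
  assumes h: "path2 G h u (x @ p @ y)" and k: "path2 G k (x @ q @ y) v"
    and F: "path2 G F p q" and F': "path2 G F' p q"
    and xy: "x \<in> lists (cells1 G)" "y \<in> lists (cells1 G)"
    and us: "length us = length u"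
    and dec: "\<And>ws. length ws = length p \<Longrightarrow>
      list_all2 (\<le>) (val F' ws) (val F ws) \<and> heat F' ws + d \<le> heat F ws"
  shows "heat (in_context G h x y k F') us + d \<le> heat (in_context G h x y k F) us"
proof -
  have "length (val h us) = length x + (length p + length y)"
    using val_length[OF h us] by simp
  then obtain as ws bs where split: "val h us = as @ ws @ bs"
    and len: "length as = length x" "length ws = length p" "length bs = length y"
    by (metis append_take_drop_id length_append add_diff_cancel_left' length_drop length_take
        min.absorb2 le_add1)
  have "heat k (as @ val F' ws @ bs) \<le> heat k (as @ val F ws @ bs)"
  proof (rule heat_mono[OF k])
    show "length (as @ val F' ws @ bs) = length (x @ q @ y)"
      using val_length[OF F'] len by simp
    show "list_all2 (\<le>) (as @ val F' ws @ bs) (as @ val F ws @ bs)"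
      using dec[OF len(2)] by (auto intro!: list_all2_appendI list_all2_refl)
  qed
  then show ?thesis
    using heat_in_context[OF h k F xy us split len] heat_in_context[OF h k F' xy us split len]
      dec[OF len(2)] by simp
qed

end

section \<open>Interpretations generated by the 2-cells\<close>

text \<open>The source as a function of the circuit: evaluating a parallel composite needs to know
  where to cut its list of inputs.\<close>

primrec csrc :: "('s, 'g) polygraph2 \<Rightarrow> ('s, 'g) circuit \<Rightarrow> 's list" where
  "csrc G (Idn x) = x"
| "csrc G (Cell \<phi>) = s1 G \<phi>"
| "csrc G (f \<star>\<^sub>0 g) = csrc G f @ csrc G g"
| "csrc G (f \<star>\<^sub>1 g) = csrc G f"

lemma csrc_arrow: "arrow G f x y \<Longrightarrow> csrc G f = x"
  by (induction rule: arrow.induct) auto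

locale cell_valuation =
  fixes G :: "('s, 'g) polygraph2"
    and cell_val :: "'g \<Rightarrow> nat list \<Rightarrow> nat list"
    and cell_heat :: "'g \<Rightarrow> nat list \<Rightarrow> nat"
  assumes wf: "polygraph2_wf G"
    and cell_val_length:
      "\<lbrakk>\<phi> \<in> cells2 G; length us = length (s1 G \<phi>)\<rbrakk>
        \<Longrightarrow> length (cell_val \<phi> us) = length (t1 G \<phi>)"
    and cell_val_mono:
      "\<lbrakk>\<phi> \<in> cells2 G; length us = length (s1 G \<phi>); list_all2 (\<le>) us vs\<rbrakk>
        \<Longrightarrow> list_all2 (\<le>) (cell_val \<phi> us) (cell_val \<phi> vs)"
    and cell_heat_mono:
      "\<lbrakk>\<phi> \<in> cells2 G; length us = length (s1 G \<phi>); list_all2 (\<le>) us vs\<rbrakk>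
        \<Longrightarrow> cell_heat \<phi> us \<le> cell_heat \<phi> vs"
begin

primrec cval :: "('s, 'g) circuit \<Rightarrow> nat list \<Rightarrow> nat list" where
  "cval (Idn x) us = us"
| "cval (Cell \<phi>) us = cell_val \<phi> us"
| "cval (f \<star>\<^sub>0 g) us =
     cval f (take (length (csrc G f)) us) @ cval g (drop (length (csrc G f)) us)"
| "cval (f \<star>\<^sub>1 g) us = cval g (cval f us)"

primrec cheat :: "('s, 'g) circuit \<Rightarrow> nat list \<Rightarrow> nat" where
  "cheat (Idn x) us = 0"
| "cheat (Cell \<phi>) us = cell_heat \<phi> us"
| "cheat (f \<star>\<^sub>0 g) us =
     cheat f (take (length (csrc G f)) us) + cheat g (drop (length (csrc G f)) us)"
| "cheat (f \<star>\<^sub>1 g) us = cheat f us + cheat g (cval f us)"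

lemma cval_length:
  "\<lbrakk>arrow G f x y; length us = length x\<rbrakk> \<Longrightarrow> length (cval f us) = length y"
  by (induction arbitrary: us rule: arrow.induct)
    (auto simp: cell_val_length csrc_arrow)

lemma cval_mono:
  "\<lbrakk>arrow G f x y; length us = length x; list_all2 (\<le>) us vs\<rbrakk>
    \<Longrightarrow> list_all2 (\<le>) (cval f us) (cval f vs)"
proof (induction arbitrary: us vs rule: arrow.induct)
  case (Par f x y g x' y')
  then show ?case
    by (auto simp: csrc_arrow intro!: list_all2_appendI)
qed (auto simp: cell_val_mono cval_length)

lemma cheat_mono:
  "\<lbrakk>arrow G f x y; length us = length x; list_all2 (\<le>) us vs\<rbrakk> \<Longrightarrow> cheat f us \<le> cheat f vs"
proof (induction arbitrary: us vs rule: arrow.induct)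
  case (Par f x y g x' y')
  then show ?case
    by (auto simp: csrc_arrow intro!: add_mono)
next
  case (Seq f x y g z)
  then show ?case by (simp add: add_mono cval_mono cval_length)
qed (auto simp: cell_heat_mono)

text \<open>The axioms of strict monoidal categories hold for maps on lists with additive heat. This
  is what lets the recursion on circuits descend to 2-paths.\<close>

lemma deform_invariant:
  "\<lbrakk>deform G f g; arrow G f x y; length us = length x\<rbrakk>
    \<Longrightarrow> cval f us = cval g us \<and> cheat f us = cheat g us"
proof (induction arbitrary: x y us rule: deform.induct)
  case (sym f g)
  then show ?case by (metis arrow_unique deform_arrow[OF wf])
next
  case (trans f g h)
  then show ?case by (metis arrow_unique deform_arrow[OF wf])
next
  case (par_cong f f' g g')
  from par_cong.prems(1) obtain x1 y1 x2 y2 where a: "arrow G f x1 y1" "arrow G g x2 y2"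
    and x: "x = x1 @ x2" by (auto elim: arrow_ParE)
  \<comment> \<open>Deformation keeps the source, so both composites cut the input list at the same
    place.\<close>
  have "csrc G f' = csrc G f"
    using deform_arrow[OF wf par_cong.hyps(1)] by (auto dest: csrc_arrow)
  then show ?case
    using par_cong.IH(1)[OF a(1), of "take (length x1) us"]
      par_cong.IH(2)[OF a(2), of "drop (length x1) us"] par_cong.prems(2) x csrc_arrow[OF a(1)]
    by simp
next
  case (seq_cong f f' g g' x' y')
  from seq_cong.prems(1) obtain w where a: "arrow G f x w" "arrow G g w y"
    by (auto elim: arrow_SeqE)
  show ?case
    using seq_cong.IH(1)[OF a(1) seq_cong.prems(2)]
      seq_cong.IH(2)[OF a(2), of "cval f us"] cval_length[OF a(1) seq_cong.prems(2)]
    by simp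
next
  case (par_assoc f g h x' y')
  then show ?case by (auto simp: take_drop add.commute)
next
  case (par_unit_right f x' y')
  then show ?case by (auto elim!: arrow_ParE arrow_IdnE dest: csrc_arrow)
next
  case (interchange f x1 y1 g z1 f' x2 y2 g' z2)
  \<comment> \<open>Uniqueness of types identifies the given source with the one from the axiom, so
    the inputs split after \<open>x1\<close>.\<close>
  have "x = x1 @ x2"
    using arrow_unique[OF arrow.Par[OF arrow.Seq arrow.Seq] interchange.prems(1)] interchange.hyps
    by blast
  with interchange show ?case by (simp add: csrc_arrow cval_length)
qed auto

text \<open>Evaluation on a representative taken by choice; \<open>deform_invariant\<close> makes
  the choice irrelevant for typed classes.\<close>

definition pval :: "('s, 'g) path2 \<Rightarrow> nat list \<Rightarrow> nat list" where
  "pval F = cval (SOME f. f \<in> F)"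

definition pheat :: "('s, 'g) path2 \<Rightarrow> nat list \<Rightarrow> nat" where
  "pheat F = cheat (SOME f. f \<in> F)"

lemma pval_pheat_cls:
  assumes "arrow G f x y" "length us = length x"
  shows "pval (cls G f) us = cval f us" "pheat (cls G f) us = cheat f us"
proof -
  have "(SOME g. g \<in> cls G f) \<in> cls G f" using assms by (metis in_cls_self someI)
  then have "deform G f (SOME g. g \<in> cls G f)" by (simp add: cls_def)
  from deform_invariant[OF this assms] show "pval (cls G f) us = cval f us"
    "pheat (cls G f) us = cheat f us" by (simp_all add: pval_def pheat_def)
qed

text \<open>The universal property of the free monoidal category: monotone data on 2-cells extend to
  an interpretation. Each law is checked on representatives.\<close>

lemma polygraphic_interpretation_cells: "polygraphic_interpretation G pval pheat"
proof
  fix F x y and us :: "nat list"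
  assume "path2 G F x y" and len: "length us = length x"
  then obtain f where f: "arrow G f x y" "F = cls G f" by (auto simp: path2_def)
  show "length (pval F us) = length y"
    using f len by (simp add: pval_pheat_cls cval_length)
  fix vs assume le: "list_all2 (\<le>) us vs"
  with len have len': "length vs = length x" by (simp add: list_all2_lengthD)
  show "list_all2 (\<le>) (pval F us) (pval F vs)"
    using f len len' le by (simp add: pval_pheat_cls cval_mono)
  show "pheat F us \<le> pheat F vs"
    using f len len' le by (simp add: pval_pheat_cls cheat_mono)
next
  fix x and us :: "nat list"
  assume "x \<in> lists (cells1 G)" "length us = length x"
  then show "pval (id2 G x) us = us" "pheat (id2 G x) us = 0"
    by (simp_all add: id2_def pval_pheat_cls[OF arrow.Idn])
next
  fix F x y F' x' y' and us vs :: "nat list"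
  assume "path2 G F x y" "path2 G F' x' y'" and len: "length us = length x" "length vs = length x'"
  then obtain f g where f: "arrow G f x y" "F = cls G f" and g: "arrow G g x' y'" "F' = cls G g"
    by (auto simp: path2_def)
  show "pval (par2 G F F') (us @ vs) = pval F us @ pval F' vs"
    "pheat (par2 G F F') (us @ vs) = pheat F us + pheat F' vs"
    using f g len pval_pheat_cls[OF arrow.Par[OF f(1) g(1)], of "us @ vs"]
    by (simp_all add: par2_cls[OF f(1) g(1)] pval_pheat_cls csrc_arrow)
next
  fix F x y F' z and us :: "nat list"
  assume "path2 G F x y" "path2 G F' y z" and len: "length us = length x"
  then obtain f g where f: "arrow G f x y" "F = cls G f" and g: "arrow G g y z" "F' = cls G g"
    by (auto simp: path2_def)
  show "pval (seq2 G F F') us = pval F' (pval F us)"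
    "pheat (seq2 G F F') us = pheat F us + pheat F' (pval F us)"
    using f g len cval_length[OF f(1) len] pval_pheat_cls[OF arrow.Seq[OF f(1) g(1)], of us]
    by (simp_all add: seq2_cls[OF f(1) g(1)] pval_pheat_cls)
qed

lemma pval_pheat_cell2:
  assumes "\<phi> \<in> cells2 G" "length us = length (s1 G \<phi>)"
  shows "pval (cell2 G \<phi>) us = cell_val \<phi> us" "pheat (cell2 G \<phi>) us = cell_heat \<phi> us"
  using assms by (simp_all add: cell2_def pval_pheat_cls[OF arrow.Cell])

end

section \<open>Structure 3-cells\<close>

lemma prog_base_simps [simp]:
  "cells1 (prog_base P) = sorts P"
  "s1 (prog_base P) = prog_s1 P"
  "t1 (prog_base P) = prog_t1 P"
  "Tau \<xi> \<zeta> \<in> cells2 (prog_base P) \<longleftrightarrow> \<xi> \<in> sorts P \<and> \<zeta> \<in> sorts P"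
  "Delta \<xi> \<in> cells2 (prog_base P) \<longleftrightarrow> \<xi> \<in> sorts P"
  "Eps \<xi> \<in> cells2 (prog_base P) \<longleftrightarrow> \<xi> \<in> sorts P"
  "Con \<gamma> \<in> cells2 (prog_base P) \<longleftrightarrow> \<gamma> \<in> constrs P"
  "Fun \<phi> \<in> cells2 (prog_base P) \<longleftrightarrow> \<phi> \<in> funcs P"
  by (auto simp: prog_base_def structure_cells_def)

text \<open>Two instances are needed: the given simple interpretation is one with \<open>c = 0\<close>, and the one
  made for the structure cells has \<open>c = 1\<close>.\<close>

locale structure_interpretation = polygraphic_interpretation "prog_base P" val heat
  for P :: "('s, 'c, 'f, 'r) program" and val and heat +
  fixes c :: nat
  assumes wf: "polygraph2_wf (prog_base P)"
    and val_Tau: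
      "\<lbrakk>\<xi> \<in> sorts P; \<zeta> \<in> sorts P\<rbrakk> \<Longrightarrow> val (cell2 (prog_base P) (Tau \<xi> \<zeta>)) [i, j] = [j, i]"
    and val_Delta:
      "\<xi> \<in> sorts P \<Longrightarrow> val (cell2 (prog_base P) (Delta \<xi>)) [i] = [i, i]"
    and heat_Tau:
      "\<lbrakk>\<xi> \<in> sorts P; \<zeta> \<in> sorts P\<rbrakk>
        \<Longrightarrow> heat (cell2 (prog_base P) (Tau \<xi> \<zeta>)) [i, j] = c * (Suc i * Suc j)"
    and heat_Delta:
      "\<xi> \<in> sorts P \<Longrightarrow> heat (cell2 (prog_base P) (Delta \<xi>)) [i] = c * (Suc i * Suc i)"
    and heat_Eps:
      "\<xi> \<in> sorts P \<Longrightarrow> heat (cell2 (prog_base P) (Eps \<xi>)) [i] = c * Suc i"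
    and heat_Con:
      "\<lbrakk>\<gamma> \<in> constrs P; length us = length (con_src P \<gamma>)\<rbrakk>
        \<Longrightarrow> heat (cell2 (prog_base P) (Con \<gamma>)) us = 0"
    and val_Con:
      "\<lbrakk>c \<noteq> 0; \<gamma> \<in> constrs P; length us = length (con_src P \<gamma>)\<rbrakk>
        \<Longrightarrow> val (cell2 (prog_base P) (Con \<gamma>)) us = [sum_list (map Suc us)]"
begin

abbreviation weight :: "nat list \<Rightarrow> nat" where
  "weight us \<equiv> sum_list (map Suc us)"

section \<open>Values and heats of \<tau>, \<delta>, \<epsilon> and of their extensions to
  1-paths\<close>

lemma evals_Tau:
  "\<lbrakk>\<xi> \<in> sorts P; \<zeta> \<in> sorts P\<rbrakk>
    \<Longrightarrow> evals (Cell (Tau \<xi> \<zeta>)) [\<xi>, \<zeta>] [\<zeta>, \<xi>] [i, j] (c * (Suc i * Suc j)) [j, i]"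
  using evals_Cell[of "Tau \<xi> \<zeta>" "[i, j]"]
  by (simp add: heat_Tau val_Tau del: mult_Suc)

lemma evals_Delta:
  "\<xi> \<in> sorts P \<Longrightarrow> evals (Cell (Delta \<xi>)) [\<xi>] [\<xi>, \<xi>] [i] (c * (Suc i * Suc i)) [i, i]"
  using evals_Cell[of "Delta \<xi>" "[i]"]
  by (simp add: heat_Delta val_Delta del: mult_Suc)

lemma evals_Eps: "\<xi> \<in> sorts P \<Longrightarrow> evals (Cell (Eps \<xi>)) [\<xi>] [] [i] (c * Suc i) []"
proof -
  assume xi: "\<xi> \<in> sorts P"
  then have a: "Eps \<xi> \<in> cells2 (prog_base P)" by simp
  \<comment> \<open>No assumption gives the value of \<epsilon>; its empty target forces the empty
    list.\<close>
  have "length (val (cell2 (prog_base P) (Eps \<xi>)) [i]) = 0"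
    using val_length[OF path2_cls[OF arrow.Cell[OF a]], of "[i]"]
    by (simp add: cell2_def)
  with evals_Cell[OF a, of "[i]"] heat_Eps[OF xi] show ?thesis by simp
qed

text \<open>The output \<open>w\<close> is determined only under the factor \<open>c\<close>: for
  \<open>c = 0\<close> a constructor may add any constant and the equation is trivial, otherwise
  \<open>val_Con\<close> gives \<open>w\<close> exactly.\<close>

lemma evals_Con:
  assumes "\<gamma> \<in> constrs P" "length us = length (con_src P \<gamma>)"
  obtains w where "evals (Cell (Con \<gamma>)) (con_src P \<gamma>) [con_tgt P \<gamma>] us 0 [w]"
    and "c * w = c * weight us"
proof -
  have a: "Con \<gamma> \<in> cells2 (prog_base P)" using assms by simp
  have "length (val (cell2 (prog_base P) (Con \<gamma>)) us) = 1"
    using val_length[OF path2_cls[OF arrow.Cell[OF a]], of us] assms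
    by (simp add: cell2_def)
  then obtain w where w: "val (cell2 (prog_base P) (Con \<gamma>)) us = [w]"
    by (auto simp: length_Suc_conv)
  show ?thesis
  proof
    show "evals (Cell (Con \<gamma>)) (con_src P \<gamma>) [con_tgt P \<gamma>] us 0 [w]"
      using evals_Cell[OF a, of us] assms w heat_Con by simp
    show "c * w = c * weight us" using val_Con[of \<gamma> us] assms w by auto
  qed
qed

lemma evals_Idn': "\<lbrakk>x \<in> lists (sorts P); length us = length x\<rbrakk> \<Longrightarrow> evals (Idn x) x x us 0 us"
  using evals_Idn by simp

lemma evals_tau_cell:
  assumes "\<xi> \<in> sorts P" "y \<in> lists (sorts P)" "length vs = length y"
  shows "evals (tau_cell \<xi> y) (\<xi> # y) (y @ [\<xi>]) (i # vs) (c * (Suc i * weight vs)) (vs @ [i])"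
  using assms(2,3)
proof (induction y arbitrary: vs rule: list.induct)
  case Nil
  then show ?case using evals_Idn'[of "[\<xi>]" "[i]"] assms(1) by simp
next
  case (Cons \<zeta> y)
  then obtain j ws where vs: "vs = j # ws" and len: "length ws = length y"
    by (auto simp: length_Suc_conv)
  have m: "\<zeta> \<in> sorts P" "y \<in> lists (sorts P)" using Cons.prems by auto
  have "evals (tau_cell \<xi> (\<zeta> # y)) (\<xi> # \<zeta> # y) (\<zeta> # y @ [\<xi>]) (i # j # ws)
    (c * (Suc i * Suc j) + c * (Suc i * weight ws)) (j # ws @ [i])"
    using evals_Seq[OF evals_Par[OF evals_Tau[of \<xi> \<zeta> i j] evals_Idn'[of y ws], simplified]
        evals_Par[OF evals_Idn'[of "[\<zeta>]" "[j]"] Cons.IH[of ws], simplified]] by (simp add: assms m len)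
  then show ?case using vs by (simp add: algebra_simps)
qed

text \<open>Every wire of \<open>x\<close> crosses every wire of \<open>y\<close> exactly once, at a
  cost of \<open>c\<close> times the product of their weights; by distributivity the sum is
  \<open>c\<close> times the product of the total weights.\<close>

lemma evals_tau_path:
  assumes "x \<in> lists (sorts P)" "length us = length x" "y \<in> lists (sorts P)" "length vs = length y"
  shows "evals (tau_path x y) (x @ y) (y @ x) (us @ vs) (c * (weight us * weight vs)) (vs @ us)"
  using assms(1,2)
proof (induction x arbitrary: us rule: list.induct)
  case Nil
  then show ?case using evals_Idn'[of y vs] assms by simp
next
  case (Cons \<xi> x)
  then obtain i ws where us: "us = i # ws" and len: "length ws = length x"
    by (auto simp: length_Suc_conv)
  have m: "\<xi> \<in> sorts P" "x \<in> lists (sorts P)" using Cons.prems by auto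
  have "evals (tau_path (\<xi> # x) y) (\<xi> # x @ y) (y @ \<xi> # x) (i # ws @ vs)
    (c * (weight ws * weight vs) + c * (Suc i * weight vs)) (vs @ i # ws)"
    using evals_Seq[OF evals_Par[OF evals_Idn'[of "[\<xi>]" "[i]"] Cons.IH[of ws], simplified]
        evals_Par[OF evals_tau_cell[of \<xi> y vs i] evals_Idn'[of x ws], simplified]] by (simp add: assms m len)
  then show ?case using us by (simp add: algebra_simps)
qed

text \<open>Only a bound is claimed: adding a wire of weight \<open>a\<close> to a word of weight
  \<open>b\<close> costs \<open>a\<close> squared plus a single crossing \<open>a * b\<close>,
  whereas the square of \<open>a + b\<close> contains this product twice.\<close>

lemma evals_delta_path:
  assumes "x \<in> lists (sorts P)" "length us = length x"
  shows "\<exists>h \<le> c * (weight us * weight us). evals (delta_path x) x (x @ x) us h (us @ us)"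
  using assms
proof (induction x arbitrary: us rule: list.induct)
  case Nil
  then show ?case using evals_Idn'[of "[]" "[]"] by simp
next
  case (Cons \<xi> x)
  then obtain i ws where us: "us = i # ws" and len: "length ws = length x"
    by (auto simp: length_Suc_conv)
  have m: "\<xi> \<in> sorts P" "x \<in> lists (sorts P)" using Cons.prems by auto
  from Cons.IH[OF m(2) len] obtain h where h: "h \<le> c * (weight ws * weight ws)"
    and e: "evals (delta_path x) x (x @ x) ws h (ws @ ws)" by blast
  have "evals (tau_path [\<xi>] x) (\<xi> # x) (x @ [\<xi>]) (i # ws) (c * (Suc i * weight ws)) (ws @ [i])"
    using evals_tau_path[of "[\<xi>]" "[i]" x ws] by (simp add: m len)
  from evals_Seq[OF evals_Par[OF evals_Delta[of \<xi> i] e, simplified]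
        evals_Par[OF evals_Idn'[of "[\<xi>]" "[i]"] evals_Par[OF this evals_Idn'[of x ws]], simplified]]
  have "evals (delta_path (\<xi> # x)) (\<xi> # x) (\<xi> # x @ \<xi> # x) (i # ws)
    (c * (Suc i * Suc i) + h + c * (Suc i * weight ws)) (i # ws @ i # ws)"
    by (simp add: m len)
  moreover have "c * (Suc i * Suc i) + h + c * (Suc i * weight ws)
      \<le> c * ((Suc i + weight ws) * (Suc i + weight ws))"
    using h by (simp add: algebra_simps)
  ultimately show ?case unfolding us by (simp only: list.map sum_list.Cons append_Cons) blast
qed

lemma evals_eps_path:
  assumes "x \<in> lists (sorts P)" "length us = length x"
  shows "evals (eps_path x) x [] us (c * weight us) []"
  using assms
proof (induction x arbitrary: us rule: list.induct)
  case Nil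
  then show ?case using evals_Idn'[of "[]" "[]"] by simp
next
  case (Cons \<xi> x)
  then obtain i ws where us: "us = i # ws" and len: "length ws = length x"
    by (auto simp: length_Suc_conv)
  have m: "\<xi> \<in> sorts P" "x \<in> lists (sorts P)" using Cons.prems by auto
  have "evals (eps_path (\<xi> # x)) (\<xi> # x) [] (i # ws) (c * Suc i + c * weight ws) []"
    using evals_Par[OF evals_Eps[of \<xi> i] Cons.IH[of ws], simplified] by (simp add: m len)
  then show ?case using us by (simp add: algebra_simps)
qed

section \<open>Comparing the two sides of a structure 3-cell\<close>

lemma evals_compare:
  assumes "evals f x y us h vs" "evals g x y us h' vs" "h' + c \<le> h"
  shows "val (cls (prog_base P) g) us = val (cls (prog_base P) f) us \<and>
    heat (cls (prog_base P) g) us + c \<le> heat (cls (prog_base P) f) us"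
  using assms by (simp add: evals_def)

text \<open>In the source the structure cell acts on the output wire of \<gamma>, in the target on
  the inputs of \<gamma>. If \<open>c\<close> is not 0, that wire weighs one more than the inputs
  together, which leaves a surplus of at least \<open>c\<close>; if \<open>c = 0\<close>, both heats
  vanish. The values agree since the same output of \<gamma> appears on both sides.\<close>

lemma structure_cell_decrease:
  assumes \<alpha>: "\<alpha> \<in> cells3 (prog_polygraph P)" "\<alpha> \<notin> range Comp"
    and p: "path2 (prog_base P) (prog_s2 P \<alpha>) p q" and us: "length us = length p"
  shows "val (prog_t2 P \<alpha>) us = val (prog_s2 P \<alpha>) us \<and>
    heat (prog_t2 P \<alpha>) us + c \<le> heat (prog_s2 P \<alpha>) us"
proof -
  have con: "con_src P \<gamma> \<in> lists (sorts P)" "con_tgt P \<gamma> \<in> sorts P" if "\<gamma> \<in> constrs P" for \<gamma>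
  proof -
    have "Con \<gamma> \<in> cells2 (prog_base P)" using that by simp
    with wf have "prog_s1 P (Con \<gamma>) \<in> lists (sorts P)" "prog_t1 P (Con \<gamma>) \<in> lists (sorts P)"
      unfolding polygraph2_wf_def by fastforce+
    then show "con_src P \<gamma> \<in> lists (sorts P)" "con_tgt P \<gamma> \<in> sorts P" by auto
  qed
  \<comment> \<open>Evaluating a circuit includes typing it, so any evaluation of a representative
    of the source identifies \<open>p\<close>.\<close>
  have src: "p = x" if "prog_s2 P \<alpha> = cls (prog_base P) f" "evals f x y vs h ws" for f x y vs h ws
    using that p path2_unique[OF wf p] path2_cls[of "prog_base P" f x y] by (auto simp: evals_def)
  from \<alpha> consider
      (TauConL) \<gamma> \<zeta> where "\<alpha> = TauConL \<gamma> \<zeta>" "\<gamma> \<in> constrs P" "\<zeta> \<in> sorts P"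
    | (TauConR) \<gamma> \<zeta> where "\<alpha> = TauConR \<zeta> \<gamma>" "\<gamma> \<in> constrs P" "\<zeta> \<in> sorts P"
    | (DeltaCon) \<gamma> where "\<alpha> = DeltaCon \<gamma>" "\<gamma> \<in> constrs P"
    | (EpsCon) \<gamma> where "\<alpha> = EpsCon \<gamma>" "\<gamma> \<in> constrs P"
    by (auto simp: prog_polygraph_def)
  then show ?thesis
  proof cases
    case TauConL
    note c = con[OF TauConL(2)]
    \<comment> \<open>Stated for arbitrary inputs because \<open>p\<close> is not known yet: the
      instance at zeros serves to find \<open>p\<close>, and then the instance at \<open>us\<close>
      compares the heats.\<close>
    have s: "\<exists>w. c * w = c * weight vs \<and>
        evals ((Cell (Con \<gamma>) \<star>\<^sub>0 Idn [\<zeta>]) \<star>\<^sub>1 Cell (Tau (con_tgt P \<gamma>) \<zeta>))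
          (con_src P \<gamma> @ [\<zeta>]) [\<zeta>, con_tgt P \<gamma>] (vs @ [j]) (c * (Suc w * Suc j)) [j, w] \<and>
        evals (tau_path (con_src P \<gamma>) [\<zeta>] \<star>\<^sub>1 (Idn [\<zeta>] \<star>\<^sub>0 Cell (Con \<gamma>)))
          (con_src P \<gamma> @ [\<zeta>]) [\<zeta>, con_tgt P \<gamma>] (vs @ [j]) (c * (weight vs * Suc j)) [j, w]"
      if len: "length vs = length (con_src P \<gamma>)" for vs j
    proof -
      obtain w where w: "evals (Cell (Con \<gamma>)) (con_src P \<gamma>) [con_tgt P \<gamma>] vs 0 [w]"
        "c * w = c * weight vs" using evals_Con[OF TauConL(2) len] by blast
      show ?thesis
        using evals_Seq[OF evals_Par[OF w(1) evals_Idn'[of "[\<zeta>]" "[j]"], simplified]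
            evals_Tau[of "con_tgt P \<gamma>" \<zeta> w j]]
          evals_Seq[OF evals_tau_path[OF c(1) len, of "[\<zeta>]" "[j]", simplified]
            evals_Par[OF evals_Idn'[of "[\<zeta>]" "[j]"] w(1), simplified]]
          TauConL c w(2) by (intro exI[of _ w]) simp
    qed
    have "p = con_src P \<gamma> @ [\<zeta>]"
      using src s[of "replicate (length (con_src P \<gamma>)) 0" 0] TauConL by fastforce
    with us obtain vs j where vs: "us = vs @ [j]" "length vs = length (con_src P \<gamma>)"
      by (auto simp: length_Suc_conv_rev)
    from s[OF vs(2), of j] obtain w where w: "c * w = c * weight vs"
      and e: "evals ((Cell (Con \<gamma>) \<star>\<^sub>0 Idn [\<zeta>]) \<star>\<^sub>1 Cell (Tau (con_tgt P \<gamma>) \<zeta>))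
          (con_src P \<gamma> @ [\<zeta>]) [\<zeta>, con_tgt P \<gamma>] us (c * (Suc w * Suc j)) [j, w]"
        "evals (tau_path (con_src P \<gamma>) [\<zeta>] \<star>\<^sub>1 (Idn [\<zeta>] \<star>\<^sub>0 Cell (Con \<gamma>)))
          (con_src P \<gamma> @ [\<zeta>]) [\<zeta>, con_tgt P \<gamma>] us (c * (weight vs * Suc j)) [j, w]"
      using vs(1) by blast
    \<comment> \<open>\<open>c * Suc w\<close> is spread out as \<open>c + c * w\<close> so that the
      only known equation about \<open>w\<close> applies; the surplus is then
      \<open>c * j\<close>.\<close>
    have "c * (weight vs * Suc j) + c \<le> (c + c * w) * Suc j"
      unfolding w by (simp add: algebra_simps)
    then have "c * (weight vs * Suc j) + c \<le> c * (Suc w * Suc j)" by (simp add: algebra_simps)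
    from evals_compare[OF e this] TauConL show ?thesis by simp
  next
    case TauConR
    note c = con[OF TauConR(2)]
    have s: "\<exists>w. c * w = c * weight vs \<and>
        evals ((Idn [\<zeta>] \<star>\<^sub>0 Cell (Con \<gamma>)) \<star>\<^sub>1 Cell (Tau \<zeta> (con_tgt P \<gamma>)))
          (\<zeta> # con_src P \<gamma>) [con_tgt P \<gamma>, \<zeta>] (j # vs) (c * (Suc j * Suc w)) [w, j] \<and>
        evals (tau_path [\<zeta>] (con_src P \<gamma>) \<star>\<^sub>1 (Cell (Con \<gamma>) \<star>\<^sub>0 Idn [\<zeta>]))
          (\<zeta> # con_src P \<gamma>) [con_tgt P \<gamma>, \<zeta>] (j # vs) (c * (Suc j * weight vs)) [w, j]"
      if len: "length vs = length (con_src P \<gamma>)" for vs j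
    proof -
      obtain w where w: "evals (Cell (Con \<gamma>)) (con_src P \<gamma>) [con_tgt P \<gamma>] vs 0 [w]"
        "c * w = c * weight vs" using evals_Con[OF TauConR(2) len] by blast
      have "evals (tau_path [\<zeta>] (con_src P \<gamma>)) (\<zeta> # con_src P \<gamma>) (con_src P \<gamma> @ [\<zeta>])
          (j # vs) (c * (Suc j * weight vs)) (vs @ [j])"
        using evals_tau_path[of "[\<zeta>]" "[j]", OF _ _ c(1) len] TauConR by simp
      from evals_Seq[OF this evals_Par[OF w(1) evals_Idn'[of "[\<zeta>]" "[j]"], simplified]]
        evals_Seq[OF evals_Par[OF evals_Idn'[of "[\<zeta>]" "[j]"] w(1), simplified]
            evals_Tau[of \<zeta> "con_tgt P \<gamma>" j w]]
      show ?thesis using TauConR c w(2) by (intro exI[of _ w]) simp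
    qed
    have "p = \<zeta> # con_src P \<gamma>"
      using src s[of "replicate (length (con_src P \<gamma>)) 0" 0] TauConR by fastforce
    with us obtain vs j where vs: "us = j # vs" "length vs = length (con_src P \<gamma>)"
      by (auto simp: length_Suc_conv)
    from s[OF vs(2), of j] obtain w where w: "c * w = c * weight vs"
      and e: "evals ((Idn [\<zeta>] \<star>\<^sub>0 Cell (Con \<gamma>)) \<star>\<^sub>1 Cell (Tau \<zeta> (con_tgt P \<gamma>)))
          (\<zeta> # con_src P \<gamma>) [con_tgt P \<gamma>, \<zeta>] us (c * (Suc j * Suc w)) [w, j]"
        "evals (tau_path [\<zeta>] (con_src P \<gamma>) \<star>\<^sub>1 (Cell (Con \<gamma>) \<star>\<^sub>0 Idn [\<zeta>]))
          (\<zeta> # con_src P \<gamma>) [con_tgt P \<gamma>, \<zeta>] us (c * (Suc j * weight vs)) [w, j]"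
      using vs(1) by blast
    have "c * (Suc j * weight vs) + c \<le> (c + c * w) * Suc j"
      unfolding w by (simp add: algebra_simps)
    then have "c * (Suc j * weight vs) + c \<le> c * (Suc j * Suc w)" by (simp add: algebra_simps)
    from evals_compare[OF e this] TauConR show ?thesis by simp
  next
    case DeltaCon
    note c = con[OF DeltaCon(2)]
    have s: "\<exists>w h. c * w = c * weight vs \<and> h \<le> c * (weight vs * weight vs) \<and>
        evals (Cell (Con \<gamma>) \<star>\<^sub>1 Cell (Delta (con_tgt P \<gamma>)))
          (con_src P \<gamma>) [con_tgt P \<gamma>, con_tgt P \<gamma>] vs (c * (Suc w * Suc w)) [w, w] \<and>
        evals (delta_path (con_src P \<gamma>) \<star>\<^sub>1 (Cell (Con \<gamma>) \<star>\<^sub>0 Cell (Con \<gamma>)))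
          (con_src P \<gamma>) [con_tgt P \<gamma>, con_tgt P \<gamma>] vs h [w, w]"
      if len: "length vs = length (con_src P \<gamma>)" for vs
    proof -
      obtain w where w: "evals (Cell (Con \<gamma>)) (con_src P \<gamma>) [con_tgt P \<gamma>] vs 0 [w]"
        "c * w = c * weight vs" using evals_Con[OF DeltaCon(2) len] by blast
      obtain h where "h \<le> c * (weight vs * weight vs)"
        "evals (delta_path (con_src P \<gamma>)) (con_src P \<gamma>) (con_src P \<gamma> @ con_src P \<gamma>) vs h (vs @ vs)"
        using evals_delta_path[OF c(1) len] by blast
      with evals_Seq[OF w(1) evals_Delta[OF c(2), of w]]
        evals_Seq[OF this(2) evals_Par[OF w(1) w(1), simplified]] w(2)
      show ?thesis by (intro exI[of _ w] exI[of _ h]) simp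
    qed
    have "p = con_src P \<gamma>"
      using src s[of "replicate (length (con_src P \<gamma>)) 0"] DeltaCon by fastforce
    with us s[of us] obtain w h where w: "c * w = c * weight us"
      and h: "h \<le> c * (weight us * weight us)"
      and e: "evals (Cell (Con \<gamma>) \<star>\<^sub>1 Cell (Delta (con_tgt P \<gamma>)))
          (con_src P \<gamma>) [con_tgt P \<gamma>, con_tgt P \<gamma>] us (c * (Suc w * Suc w)) [w, w]"
        "evals (delta_path (con_src P \<gamma>) \<star>\<^sub>1 (Cell (Con \<gamma>) \<star>\<^sub>0 Cell (Con \<gamma>)))
          (con_src P \<gamma>) [con_tgt P \<gamma>, con_tgt P \<gamma>] us h [w, w]"
      by blast
    \<comment> \<open>Both sides vanish for \<open>c = 0\<close>; otherwise \<open>c\<close> cancels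
      in the equation for \<open>w\<close>.\<close>
    have "c * (weight us * weight us) = c * (w * w)"
      using w by (cases "c = 0") auto
    with h have "h + c \<le> c * (Suc w * Suc w)" by (simp add: algebra_simps)
    from evals_compare[OF e this] DeltaCon show ?thesis by simp
  next
    case EpsCon
    note c = con[OF EpsCon(2)]
    have s: "\<exists>w. c * w = c * weight vs \<and>
        evals (Cell (Con \<gamma>) \<star>\<^sub>1 Cell (Eps (con_tgt P \<gamma>))) (con_src P \<gamma>) [] vs (c * Suc w) []"
      if len: "length vs = length (con_src P \<gamma>)" for vs
    proof -
      obtain w where w: "evals (Cell (Con \<gamma>)) (con_src P \<gamma>) [con_tgt P \<gamma>] vs 0 [w]"
        "c * w = c * weight vs" using evals_Con[OF EpsCon(2) len] by blast
      then show ?thesis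
        using evals_Seq[OF w(1) evals_Eps[OF c(2), of w]] by (intro exI[of _ w]) simp
    qed
    have p: "p = con_src P \<gamma>"
      using src s[of "replicate (length (con_src P \<gamma>)) 0"] EpsCon by fastforce
    with us s[of us] obtain w where w: "c * w = c * weight us"
      and e: "evals (Cell (Con \<gamma>) \<star>\<^sub>1 Cell (Eps (con_tgt P \<gamma>))) (con_src P \<gamma>) [] us (c * Suc w) []"
      by blast
    have "c * weight us + c \<le> c * Suc w" using w by (simp only: mult_Suc_right add.commute)
    from evals_compare[OF e evals_eps_path[OF c(1)] this] EpsCon us p show ?thesis by simp
  qed
qed

end

section \<open>The interpretation made for the structure cells\<close>

text \<open>Structure 3-cells contain no function, so any monotone value of the right length would
  do for \<open>Fun\<close>; constant zeros are chosen.\<close>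

primrec weight_val :: "('s, 'c, 'f, 'r) program \<Rightarrow> ('s, 'c, 'f) prog_cell2 \<Rightarrow> nat list \<Rightarrow> nat list"
where
  "weight_val P (Tau \<xi> \<zeta>) us = rev us"
| "weight_val P (Delta \<xi>) us = us @ us"
| "weight_val P (Eps \<xi>) us = []"
| "weight_val P (Con \<gamma>) us = [sum_list (map Suc us)]"
| "weight_val P (Fun \<phi>) us = replicate (length (fun_tgt P \<phi>)) 0"

text \<open>Writing the heats as products over the whole input list reduces their monotonicity to
  that of one product.\<close>

primrec weight_heat :: "('s, 'c, 'f) prog_cell2 \<Rightarrow> nat list \<Rightarrow> nat" where
  "weight_heat (Tau \<xi> \<zeta>) us = prod_list (map Suc us)"
| "weight_heat (Delta \<xi>) us = prod_list (map Suc us) * prod_list (map Suc us)"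
| "weight_heat (Eps \<xi>) us = prod_list (map Suc us)"
| "weight_heat (Con \<gamma>) us = 0"
| "weight_heat (Fun \<phi>) us = 0"

lemma prod_list_Suc_mono:
  "list_all2 (\<le>) us vs \<Longrightarrow> prod_list (map Suc us) \<le> prod_list (map Suc vs)"
  by (induction rule: list_all2_induct) (auto intro!: mult_le_mono simp del: mult_Suc)

lemma sum_list_Suc_mono:
  "list_all2 (\<le>) us vs \<Longrightarrow> sum_list (map Suc us) \<le> sum_list (map Suc vs)"
  by (induction rule: list_all2_induct) auto

lemma cell_valuation_weight:
  assumes "polygraph2_wf (prog_base P)"
  shows "cell_valuation (prog_base P) (weight_val P) weight_heat"
proof
  fix \<phi> and us :: "nat list"
  assume \<phi>: "\<phi> \<in> cells2 (prog_base P)" and len: "length us = length (s1 (prog_base P) \<phi>)"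
  then show "length (weight_val P \<phi> us) = length (t1 (prog_base P) \<phi>)"
    by (cases \<phi>) auto
  fix vs assume "list_all2 (\<le>) us vs"
  then show "list_all2 (\<le>) (weight_val P \<phi> us) (weight_val P \<phi> vs)"
    using sum_list_Suc_mono
    by (cases \<phi>) (auto intro!: list_all2_appendI simp: list_all2_same)
  show "weight_heat \<phi> us \<le> weight_heat \<phi> vs"
    using prod_list_Suc_mono[OF \<open>list_all2 (\<le>) us vs\<close>] by (cases \<phi>) (auto intro: mult_le_mono)
qed (rule assms)

lemma ex_structure_interpretation:
  fixes P :: "('s, 'c, 'f, 'r) program"
  assumes "polygraph2_wf (prog_base P)"
  shows "\<exists>val heat. structure_interpretation P val heat 1"
proof -
  interpret cell_valuation "prog_base P" "weight_val P" weight_heat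
    by (rule cell_valuation_weight[OF assms])
  interpret polygraphic_interpretation "prog_base P" pval pheat
    by (rule polygraphic_interpretation_cells)
  have "structure_interpretation P pval pheat 1"
    by unfold_locales
      (use assms in \<open>simp_all add: pval_pheat_cell2\<close>)
  then show ?thesis by blast
qed

text \<open>With \<open>c = 0\<close> the prescribed heats are all 0 and the condition on
  constructor values is vacuous, which leaves room for the constants added by the
  constructors.\<close>

lemma (in simple_interpretation) structure_interpretation_0:
  assumes "polygraph2_wf (prog_base P)"
  shows "structure_interpretation P val heat 0"
  by unfold_locales
    (use assms in \<open>simp_all add: val_Tau val_Delta heat_Tau heat_Delta heat_Eps heat_constructor\<close>)

section \<open>Termination\<close>

lemma rewrite_stepE:
  assumes "rewrite_step P F F'"
  obtains \<alpha> h x y k u v p q where "\<alpha> \<in> cells3 P"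
    "path2 (base P) (s2 P \<alpha>) p q" "path2 (base P) (t2 P \<alpha>) p q"
    "x \<in> lists (cells1 (base P))" "y \<in> lists (cells1 (base P))"
    "path2 (base P) h u (x @ p @ y)" "path2 (base P) k (x @ q @ y) v"
    "F = in_context (base P) h x y k (s2 P \<alpha>)" "F' = in_context (base P) h x y k (t2 P \<alpha>)"
  using assms unfolding rewrite_step_def by blast

lemma path2_in_context:
  assumes "path2 G h u (x @ p @ y)" "path2 G k (x @ q @ y) v" "path2 G F p q"
    "x \<in> lists (cells1 G)" "y \<in> lists (cells1 G)"
  shows "path2 G (in_context G h x y k F) u v"
proof -
  have "path2 G (par2 G (par2 G (id2 G x) F) (id2 G y)) ((x @ p) @ y) ((x @ q) @ y)"
    by (intro path2_par2 path2_id2 assms)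
  then have "path2 G (par2 G (par2 G (id2 G x) F) (id2 G y)) (x @ p @ y) (x @ q @ y)" by simp
  with assms show ?thesis unfolding in_context_def by (blast intro: path2_seq2)
qed

text \<open>Both sides of a 3-cell are parallel and are placed in the same context. Hence a whole
  rewriting sequence can be evaluated at one fixed input.\<close>

lemma rewrite_step_path2:
  assumes "rewrite_step P F F'"
  obtains u v where "path2 (base P) F u v" "path2 (base P) F' u v"
  using assms by (elim rewrite_stepE) (metis path2_in_context)

theorem theorem3p6:
  fixes P :: "('s, 'c, 'f, 'r) program"
  assumes "simple_program P"
  shows "\<not> (\<exists>f :: nat \<Rightarrow> ('s, ('s, 'c, 'f) prog_cell2) path2.
           \<forall>n. rewrite_step (prog_polygraph P) (f n) (f (Suc n)))"
proof
  assume "\<exists>f :: nat \<Rightarrow> ('s, ('s, 'c, 'f) prog_cell2) path2.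
           \<forall>n. rewrite_step (prog_polygraph P) (f n) (f (Suc n))"
  then obtain f :: "nat \<Rightarrow> ('s, ('s, 'c, 'f) prog_cell2) path2"
    where step: "\<And>n. rewrite_step (prog_polygraph P) (f n) (f (Suc n))" by blast
  let ?G = "prog_base P"
  have base: "base (prog_polygraph P) = ?G" "s2 (prog_polygraph P) = prog_s2 P"
    "t2 (prog_polygraph P) = prog_t2 P" by (simp_all add: prog_polygraph_def)
  have wf: "polygraph2_wf ?G"
    using assms
    by (simp add: simple_program_def polygraphic_program_def polygraph3_wf_def polygraph2_wf_def base)
  from assms obtain val heat where simple: "simple_interpretation P val heat"
    and comp: "\<And>r. r \<in> comps P \<Longrightarrow> compatible_with (prog_polygraph P) val heat (Comp r)"
    by (auto simp: simple_program_def)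
  interpret S: structure_interpretation P val heat 0
    by (rule simple_interpretation.structure_interpretation_0[OF simple wf])
  obtain val' heat' where "structure_interpretation P val' heat' 1"
    using ex_structure_interpretation[OF wf] by blast
  then interpret W: structure_interpretation P val' heat' 1 .
  obtain u v where "path2 ?G (f 0) u v"
    using rewrite_step_path2[OF step[of 0]] unfolding base by blast
  have f: "path2 ?G (f n) u v" for n
  proof (induction n)
    case (Suc n)
    then show ?case
      using rewrite_step_path2[OF step[of n]] path2_unique[OF wf Suc] by (metis base(1))
  qed fact
  \<comment> \<open>Any vector of the right length would serve; what matters is that it is the same
    for all \<open>n\<close>.\<close>
  define us :: "nat list" where "us = replicate (length u) 0"
  have us: "length us = length u" by (simp add: us_def)
  \<comment> \<open>A computation step lowers the first component, whatever happens to the second; a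
    structure step does not raise the first and lowers the second.\<close>
  have "((heat (f (Suc n)) us, heat' (f (Suc n)) us), (heat (f n) us, heat' (f n) us))
      \<in> less_than <*lex*> less_than" for n
  proof -
    from step[of n] obtain \<alpha> h x y k u' v' p q where \<alpha>: "\<alpha> \<in> cells3 (prog_polygraph P)"
      and s: "path2 ?G (prog_s2 P \<alpha>) p q" and t: "path2 ?G (prog_t2 P \<alpha>) p q"
      and xy: "x \<in> lists (cells1 ?G)" "y \<in> lists (cells1 ?G)"
      and h: "path2 ?G h u' (x @ p @ y)" and k: "path2 ?G k (x @ q @ y) v'"
      and F: "f n = in_context ?G h x y k (prog_s2 P \<alpha>)"
      and F': "f (Suc n) = in_context ?G h x y k (prog_t2 P \<alpha>)"
      by (elim rewrite_stepE) (auto simp: base)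
    \<comment> \<open>The source \<open>u'\<close> of the context is that of \<open>f n\<close>,
      hence equal to \<open>u\<close>.\<close>
    have len: "length us = length u'"
      using path2_unique[OF wf f[of n]] path2_in_context[OF h k s xy] F us by simp
    show ?thesis
    proof (cases "\<alpha> \<in> range Comp")
      case True
      then obtain r where r: "\<alpha> = Comp r" "r \<in> comps P"
        using \<alpha> by (auto simp: prog_polygraph_def)
      have "heat (f (Suc n)) us + 1 \<le> heat (f n) us"
        unfolding F F'
      proof (rule S.heat_in_context_decrease[OF h k s t xy len])
        fix ws :: "nat list" assume "length ws = length p"
        with comp[OF r(2)] s r(1) have "list_all2 (\<ge>) (val (prog_s2 P \<alpha>) ws) (val (prog_t2 P \<alpha>) ws)"
          "heat (prog_t2 P \<alpha>) ws < heat (prog_s2 P \<alpha>) ws"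
          unfolding compatible_with_def base by blast+
        then show "list_all2 (\<le>) (val (prog_t2 P \<alpha>) ws) (val (prog_s2 P \<alpha>) ws) \<and>
            heat (prog_t2 P \<alpha>) ws + 1 \<le> heat (prog_s2 P \<alpha>) ws"
          by (auto simp: list_all2_conv_all_nth)
      qed
      then show ?thesis by simp
    next
      case False
      have "heat (f (Suc n)) us + 0 \<le> heat (f n) us"
        unfolding F F'
        by (rule S.heat_in_context_decrease[OF h k s t xy len])
          (use S.structure_cell_decrease[OF \<alpha> False s] in \<open>simp add: list_all2_same\<close>)
      moreover have "heat' (f (Suc n)) us + 1 \<le> heat' (f n) us"
        unfolding F F'
        by (rule W.heat_in_context_decrease[OF h k s t xy len])
          (use W.structure_cell_decrease[OF \<alpha> False s] in \<open>simp add: list_all2_same\<close>)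
      ultimately show ?thesis by auto
    qed
  qed
  then have "\<exists>g. \<forall>n. (g (Suc n), g n) \<in> less_than <*lex*> less_than"
    by (intro exI[of _ "\<lambda>n. (heat (f n) us, heat' (f n) us)"]) blast
  moreover have "wf (less_than <*lex*> less_than)" by (simp add: wf_lex_prod)
  ultimately show False unfolding wf_iff_no_infinite_down_chain by blast
qed

end
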